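(* Let $G$ be a locally compact abelian group and let $p$ be a non-zero polynomial on $G$. Let $F$ be a dense subalgebra of $L^1(G)$ which is translation invariant, is closed under pointwise multiplication by characters $\gamma\in\widehat{G}$, and is such that for each $\gamma\in\widehat{G}$ the ideal $\{f\in F:\hat f(\gamma)=0\}$ of $F$ is dense in $\{f\in L^1(G):\hat f(\gamma)=0\}$. Suppose that $f^**p$ is well-defined for all $f\in F$. Then $sp_F(\gamma p)=\{\gamma\}$ for all $\gamma\in\widehat{G}$.
   Context: $G$ is written additively and equipped with Haar measure; functions agreeing almost everywhere are identified. $\widehat{G}$ is the dual group, written multiplicatively, with action $(x,\gamma)=\gamma(x)$. $L^1(G)$ is the convolution algebra, $\hat f(\gamma)=\int_G f(x)(-x,\gamma)\,dx$ and $f^*(x)=\overline{f(-x)}$. For $y\in G$, $\varphi_y(x)=\varphi(x+y)$ and $\Delta_y\varphi(x)=\varphi(x+y)-\varphi(x)$. A polynomial on $G$ of degree $n$ is a continuous function $\varphi:G\to\mathbb{C}$ such that $\Delta_{y_1}\cdots\Delta_{y_{n+1}}\varphi=0$ for all $y_1,\dots,y_{n+1}\in G$ and $\Delta_{y_1}\cdots\Delta_{y_n}\varphi\ne0$ for some $y_1,\dots,y_n\in G$. $L^\infty_{loc}(G)$ is the set of $\varphi:G\to\mathbb{C}$ with $\chi_K\varphi\in L^\infty(G)$ for every compact $K\subset G$. For $f\in F$, $\varphi\in L^\infty_{loc}(G)$, "$f^**\varphi$ is well-defined" means $f_y\varphi\in L^1(G)$ and $f\varphi_y\in L^1(G)$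 for almost every $y\in G$; then $f^**\varphi(x)=\int_G f^*(x-y)\varphi(y)\,dy=\int_G f^*(y)\varphi(x-y)\,dy$ a.e. If $f^**\varphi$ is well-defined for all $f\in F$, put $I_F(\varphi)=\{f\in F: f^**\varphi=0\}$ and $sp_F(\varphi)=\{\gamma\in\widehat G:\hat f(\gamma)=0\text{ for all }f\in I_F(\varphi)\}$. *)

theory Defs
  imports "HOL-Analysis.Analysis"
begin

text \<open>
  A locally compact abelian group is a type of classes \<open>topological_ab_group_add\<close> and \<open>t2_space\<close>
  that satisfies \<open>locally_compact_space euclidean\<close>; as usual, the Hausdorff property is part of the
  notion.
\<close>

text \<open>Haar measures are Radon measures on the Borel sets of the group, \<open>\<sigma>\<close>-finite or not.\<close>

definition haar_measure :: "'a::{topological_ab_group_add, t2_space} measure \<Rightarrow> bool" where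
  "haar_measure M \<longleftrightarrow>
     sets M = sets borel \<and>
     emeasure M UNIV \<noteq> 0 \<and>
     (\<forall>K. compact K \<longrightarrow> emeasure M K < \<infinity>) \<and>
     (\<forall>A\<in>sets borel. emeasure M A = (INF U\<in>{U. open U \<and> A \<subseteq> U}. emeasure M U)) \<and>
     (\<forall>U. open U \<longrightarrow> emeasure M U = (SUP K\<in>{K. compact K \<and> K \<subseteq> U}. emeasure M K)) \<and>
     (\<forall>x. \<forall>A\<in>sets borel. emeasure M ((+) x ` A) = emeasure M A)"

definition dual_group :: "('a::topological_ab_group_add \<Rightarrow> complex) set" where
  "dual_group = {\<gamma>. continuous_on UNIV \<gamma> \<and> (\<forall>x. norm (\<gamma> x) = 1) \<and> (\<forall>x y. \<gamma> (x + y) = \<gamma> x * \<gamma> y)}"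

definition translate :: "'a::ab_group_add \<Rightarrow> ('a \<Rightarrow> complex) \<Rightarrow> 'a \<Rightarrow> complex" where
  "translate y \<phi> = (\<lambda>x. \<phi> (x + y))"

definition difference :: "'a::ab_group_add \<Rightarrow> ('a \<Rightarrow> complex) \<Rightarrow> 'a \<Rightarrow> complex" where
  "difference y \<phi> = (\<lambda>x. \<phi> (x + y) - \<phi> x)"

text \<open>\<open>foldr difference [y\<^sub>1, \<dots>, y\<^sub>k] \<phi>\<close> is \<open>\<Delta>\<^bsub>y\<^sub>1\<^esub> \<dots> \<Delta>\<^bsub>y\<^sub>k\<^esub> \<phi>\<close>.\<close>

definition polynomial_of_degree :: "nat \<Rightarrow> ('a::topological_ab_group_add \<Rightarrow> complex) \<Rightarrow> bool" where
  "polynomial_of_degree n \<phi> \<longleftrightarrow>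
     continuous_on UNIV \<phi> \<and>
     (\<forall>ys. length ys = n + 1 \<longrightarrow> foldr difference ys \<phi> = (\<lambda>_. 0)) \<and>
     (\<exists>ys. length ys = n \<and> foldr difference ys \<phi> \<noteq> (\<lambda>_. 0))"

text \<open>
  The elements of \<open>L\<^sup>1\<close> and \<open>L\<^sup>\<infinity>\<close> are functions, not classes modulo equality almost everywhere. A subset
  of the usual \<open>L\<^sup>1(G)\<close> is represented by the union of its classes; see \<open>L1_subset\<close>.
\<close>

definition L1 :: "'a::{topological_ab_group_add, t2_space} measure \<Rightarrow> ('a \<Rightarrow> complex) set" where
  "L1 M = {f. integrable M f}"

definition L1_subset :: "'a::{topological_ab_group_add, t2_space} measure \<Rightarrow> ('a \<Rightarrow> complex) set \<Rightarrow> bool" where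
  "L1_subset M F \<longleftrightarrow> F \<subseteq> L1 M \<and> (\<forall>f\<in>F. \<forall>g\<in>L1 M. (AE x in M. f x = g x) \<longrightarrow> g \<in> F)"

definition L1_dense_in ::
  "'a::{topological_ab_group_add, t2_space} measure \<Rightarrow> ('a \<Rightarrow> complex) set \<Rightarrow> ('a \<Rightarrow> complex) set \<Rightarrow> bool" where
  "L1_dense_in M A B \<longleftrightarrow> A \<subseteq> B \<and> (\<forall>g\<in>B. \<forall>\<epsilon>>0. \<exists>f\<in>A. (\<integral>x. norm (g x - f x) \<partial>M) < \<epsilon>)"

definition Linf :: "'a::{topological_ab_group_add, t2_space} measure \<Rightarrow> ('a \<Rightarrow> complex) set" where
  "Linf M = {\<phi> \<in> borel_measurable M. \<exists>C. AE x in M. norm (\<phi> x) \<le> C}"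

definition Linf_loc :: "'a::{topological_ab_group_add, t2_space} measure \<Rightarrow> ('a \<Rightarrow> complex) set" where
  "Linf_loc M = {\<phi>. \<forall>K. compact K \<longrightarrow> (\<lambda>x. indicator K x * \<phi> x) \<in> Linf M}"

definition conv ::
  "'a::{topological_ab_group_add, t2_space} measure \<Rightarrow> ('a \<Rightarrow> complex) \<Rightarrow> ('a \<Rightarrow> complex) \<Rightarrow> 'a \<Rightarrow> complex" where
  "conv M f g = (\<lambda>x. \<integral>y. f (x - y) * g y \<partial>M)"

definition star :: "('a::ab_group_add \<Rightarrow> complex) \<Rightarrow> 'a \<Rightarrow> complex" where
  "star f = (\<lambda>x. cnj (f (- x)))"

definition fourier ::
  "'a::{topological_ab_group_add, t2_space} measure \<Rightarrow> ('a \<Rightarrow> complex) \<Rightarrow> ('a \<Rightarrow> complex) \<Rightarrow> complex" where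
  "fourier M f \<gamma> = (\<integral>x. f x * \<gamma> (- x) \<partial>M)"

definition L1_subalgebra :: "'a::{topological_ab_group_add, t2_space} measure \<Rightarrow> ('a \<Rightarrow> complex) set \<Rightarrow> bool" where
  "L1_subalgebra M F \<longleftrightarrow>
     L1_subset M F \<and>
     (\<lambda>_. 0) \<in> F \<and>
     (\<forall>f\<in>F. \<forall>g\<in>F. (\<lambda>x. f x + g x) \<in> F) \<and>
     (\<forall>c. \<forall>f\<in>F. (\<lambda>x. c * f x) \<in> F) \<and>
     (\<forall>f\<in>F. \<forall>g\<in>F. conv M f g \<in> F)"

text \<open>\<open>f\<^sup>* * \<phi>\<close> is well-defined.\<close>

definition star_conv_defined ::
  "'a::{topological_ab_group_add, t2_space} measure \<Rightarrow> ('a \<Rightarrow> complex) \<Rightarrow> ('a \<Rightarrow> complex) \<Rightarrow> bool" where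
  "star_conv_defined M f \<phi> \<longleftrightarrow>
     (AE y in M. (\<lambda>x. translate y f x * \<phi> x) \<in> L1 M \<and> (\<lambda>x. f x * translate y \<phi> x) \<in> L1 M)"

text \<open>
  The following two sets are meaningful only if \<open>\<phi> \<in> Linf_loc M\<close> and \<open>star_conv_defined M f \<phi>\<close> for
  all \<open>f \<in> F\<close>.
\<close>

definition ann_ideal ::
  "'a::{topological_ab_group_add, t2_space} measure \<Rightarrow> ('a \<Rightarrow> complex) set \<Rightarrow> ('a \<Rightarrow> complex) \<Rightarrow> ('a \<Rightarrow> complex) set" where
  "ann_ideal M F \<phi> = {f \<in> F. AE x in M. conv M (star f) \<phi> x = 0}"

definition sp ::
  "'a::{topological_ab_group_add, t2_space} measure \<Rightarrow> ('a \<Rightarrow> complex) set \<Rightarrow> ('a \<Rightarrow> complex) \<Rightarrow> ('a \<Rightarrow> complex) set" where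
  "sp M F \<phi> = {\<gamma> \<in> dual_group. \<forall>f\<in>ann_ideal M F \<phi>. fourier M f \<gamma> = 0}"

end

theory Submission
  imports Defs
begin

text \<open>
  Convolution commutes with differences: \<open>(\<Delta>\<^sub>y g)\<^sup>* * p = g\<^sup>* * (\<Delta>\<^bsub>-y\<^esub> p)\<close>. If \<open>f\<^sup>* * p = 0\<close> and
  \<open>\<Delta>\<^bsub>y\<^sub>1\<^esub> \<dots> \<Delta>\<^bsub>y\<^sub>n\<^esub> p\<close> is a non-zero constant \<open>c\<close>, then \<open>f\<^sup>* * c = 0\<close>, that is, \<open>f\<close> has integral
  \<open>0\<close>; so the trivial character belongs to the spectrum of \<open>p\<close>. Conversely, if \<open>\<psi> y \<noteq> 1\<close>, choose \<open>g \<in> F\<close> whose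
  transform does not vanish at \<open>\<psi>\<close>. The function \<open>\<Delta>\<^sub>y \<dots> \<Delta>\<^sub>y g\<close> (\<open>n + 1\<close> differences) annihilates
  \<open>p\<close>, and its transform at \<open>\<psi>\<close> is that of \<open>g\<close> times \<open>(\<psi> y - 1)\<^bsup>n+1\<^esup> \<noteq> 0\<close>. Multiplication by
  \<open>\<gamma>\<close> reduces the spectrum of \<open>\<gamma> p\<close> to that of \<open>p\<close>.
\<close>

section \<open>Characters, and the top difference of a polynomial\<close>

lemma dual_group_minus:
  assumes "\<gamma> \<in> dual_group"
  shows "\<gamma> (- x) = cnj (\<gamma> x)"
proof -
  have n: "norm (\<gamma> x) = 1" and m: "\<gamma> (x + y) = \<gamma> x * \<gamma> y" for x y
    using assms by (auto simp: dual_group_def)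
  have "\<gamma> 0 = \<gamma> 0 * \<gamma> 0"
    using m[of 0 0] by simp
  moreover have "\<gamma> 0 \<noteq> 0"
    using n[of 0] by auto
  ultimately have "\<gamma> 0 = 1"
    by simp
  then have "\<gamma> x * \<gamma> (- x) = 1"
    using m[of x "- x"] by simp
  moreover have "\<gamma> x * cnj (\<gamma> x) = 1"
    using n[of x] by (simp add: complex_norm_square[symmetric])
  moreover have "\<gamma> x \<noteq> 0"
    using n[of x] by auto
  ultimately show ?thesis
    by (metis mult_cancel_left)
qed

lemma dual_group_mult_cnj:
  assumes "\<gamma> \<in> dual_group"
  shows "\<gamma> x * cnj (\<gamma> x) = 1" "cnj (\<gamma> x) * \<gamma> x = 1"
proof -
  have "norm (\<gamma> x) = 1"
    using assms by (simp add: dual_group_def)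
  then show "\<gamma> x * cnj (\<gamma> x) = 1"
    by (simp add: complex_norm_square[symmetric])
  then show "cnj (\<gamma> x) * \<gamma> x = 1"
    by (simp only: mult.commute)
qed

lemma dual_group_cnj: "\<gamma> \<in> dual_group \<Longrightarrow> (\<lambda>x. cnj (\<gamma> x)) \<in> dual_group"
  by (auto simp: dual_group_def intro!: continuous_intros)

lemma dual_group_mult:
  "\<gamma> \<in> dual_group \<Longrightarrow> \<psi> \<in> dual_group \<Longrightarrow> (\<lambda>x. \<gamma> x * \<psi> x) \<in> dual_group"
  by (auto simp: dual_group_def norm_mult intro!: continuous_intros)

lemma fourier_mult_character:
  assumes "\<gamma> \<in> dual_group"
  shows "fourier M (\<lambda>x. \<gamma> x * f x) \<psi> = fourier M f (\<lambda>x. cnj (\<gamma> x) * \<psi> x)"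
  by (simp add: fourier_def dual_group_minus[OF assms] mult_ac)

text \<open>The factor \<open>cnj (\<gamma> (y - x)) * \<gamma> y\<close> equals
  \<open>\<gamma> x\<close>, free of the integration variable. Hence multiplication by
  \<open>\<gamma>\<close> carries annihilators of \<open>\<phi>\<close> to annihilators of
  \<open>\<gamma> \<phi>\<close>.\<close>

lemma conv_star_mult_character:
  assumes "\<gamma> \<in> dual_group"
  shows "conv M (star (\<lambda>x. \<gamma> x * f x)) (\<lambda>x. \<gamma> x * \<phi> x) x = \<gamma> x * conv M (star f) \<phi> x"
proof -
  have "cnj (\<gamma> (y - x)) * \<gamma> y = \<gamma> x" for y
  proof -
    have "\<gamma> y = \<gamma> (y - x) * \<gamma> x"
      using assms unfolding dual_group_def
      by (metis (mono_tags, lifting) diff_add_cancel mem_Collect_eq)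
    then show ?thesis
      using dual_group_mult_cnj[OF assms] by (metis mult.assoc mult_1_left)
  qed
  then have "star (\<lambda>x. \<gamma> x * f x) (x - y) * (\<gamma> y * \<phi> y) = \<gamma> x * (star f (x - y) * \<phi> y)" for y
    by (simp add: star_def mult_ac)
  \<comment> \<open>The constant \<open>\<gamma> x\<close> comes out even where the integral
    diverges: both sides then have the default value 0.\<close>
  then show ?thesis
    by (simp only: conv_def integral_mult_right_zero)
qed

text \<open>One more difference of a nonzero n-fold difference vanishes; read at the point 0 in
  direction \<open>y\<close>, this says that the values at \<open>y\<close> and at 0 agree.\<close>

lemma foldr_difference_constant:
  assumes "polynomial_of_degree n p"
  obtains ys c where "c \<noteq> 0" "foldr difference ys p = (\<lambda>_. c)"
proof -
  obtain ys where ys: "length ys = n" "foldr difference ys p \<noteq> (\<lambda>_. 0)"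
    using assms by (auto simp: polynomial_of_degree_def)
  let ?q = "foldr difference ys p"
  have "?q y = ?q 0" for y
  proof -
    have "foldr difference (y # ys) p = (\<lambda>_. 0)"
      using assms ys(1) unfolding polynomial_of_degree_def
      by (metis Suc_eq_plus1 length_Cons)
    then have "difference y ?q 0 = 0"
      by simp
    then show ?thesis
      by (simp add: difference_def)
  qed
  then have eq: "?q = (\<lambda>_. ?q 0)"
    by blast
  with ys(2) have "?q 0 \<noteq> 0"
    by metis
  then show thesis
    using eq that by blast
qed

section \<open>Haar measure: translation invariance and integrability\<close>

locale haar =
  fixes M :: "'a::{topological_ab_group_add, t2_space} measure"
  assumes haar: "haar_measure M"
begin

lemma sets_M [measurable_cong, simp]: "sets M = sets borel"
  using haar unfolding haar_measure_def by (rule conjunct1)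

lemma space_M [simp]: "space M = UNIV"
  using sets_eq_imp_space_eq[OF sets_M] by simp

lemma emeasure_UNIV: "emeasure M UNIV \<noteq> 0"
  using haar unfolding haar_measure_def by - (elim conjE)

lemma emeasure_compact_finite:
  assumes "compact K"
  shows "emeasure M K < \<infinity>"
proof -
  have "\<forall>K. compact K \<longrightarrow> emeasure M K < \<infinity>"
    using haar unfolding haar_measure_def by - (elim conjE)
  with assms show ?thesis
    by simp
qed

text \<open>Inner regularity of the open set \<open>UNIV\<close>; it later supplies a compact set of
  positive measure.\<close>

lemma emeasure_UNIV_eq_SUP: "emeasure M UNIV = (SUP K\<in>{K. compact K}. emeasure M K)"
proof -
  have "\<forall>U. open U \<longrightarrow> emeasure M U = (SUP K\<in>{K. compact K \<and> K \<subseteq> U}. emeasure M K)"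
    using haar unfolding haar_measure_def by - (elim conjE)
  from this[rule_format, OF open_UNIV] show ?thesis
    by simp
qed

lemma emeasure_translation:
  assumes "A \<in> sets borel"
  shows "emeasure M ((+) x ` A) = emeasure M A"
proof -
  have "\<forall>x. \<forall>A\<in>sets borel. emeasure M ((+) x ` A) = emeasure M A"
    using haar unfolding haar_measure_def by - (elim conjE)
  with assms show ?thesis
    by simp
qed

lemma continuous_measurable:
  fixes \<phi> :: "'a \<Rightarrow> 'b::topological_space"
  assumes "continuous_on UNIV \<phi>"
  shows "\<phi> \<in> borel_measurable M"
  using borel_measurable_continuous_onI[OF assms] by (simp cong: measurable_cong_sets)

lemma dual_group_measurable:
  assumes "\<gamma> \<in> dual_group"
  shows "\<gamma> \<in> borel_measurable M"
  using assms by (intro continuous_measurable) (simp add: dual_group_def)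

lemma translation_measurable: "(\<lambda>x. x + z) \<in> measurable M M"
proof -
  have "(\<lambda>x. x + z) \<in> borel_measurable M"
    by (intro continuous_measurable continuous_intros)
  then show ?thesis
    by (simp cong: measurable_cong_sets)
qed

text \<open>Invariance is given for images, while the push-forward involves preimages; the preimage
  under adding \<open>z\<close> is the image under adding \<open>- z\<close>. Changes of variables
  for integrals and for almost-everywhere statements follow.\<close>

lemma distr_translation: "distr M M (\<lambda>x. x + z) = M"
proof (rule measure_eqI)
  fix A
  assume "A \<in> sets (distr M M (\<lambda>x. x + z))"
  then have A: "A \<in> sets borel"
    by simp
  have "(\<lambda>x. x + z) -` A = (+) (- z) ` A"
    by (force simp: image_iff algebra_simps)
  then show "emeasure (distr M M (\<lambda>x. x + z)) A = emeasure M A"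
    using A emeasure_translation[of A "- z"]
    by (simp add: emeasure_distr translation_measurable del: add_uminus_conv_diff)
qed simp

lemma integral_translation:
  fixes f :: "'a \<Rightarrow> complex"
  assumes "f \<in> borel_measurable M"
  shows "(\<integral>x. f (x + z) \<partial>M) = (\<integral>x. f x \<partial>M)"
  using integral_distr[OF translation_measurable[of z] assms] by (simp add: distr_translation)

lemma integrable_translation:
  fixes f :: "'a \<Rightarrow> complex"
  assumes "f \<in> borel_measurable M"
  shows "integrable M (\<lambda>x. f (x + z)) \<longleftrightarrow> integrable M f"
  using integrable_distr_eq[OF translation_measurable[of z] assms] by (simp add: distr_translation)

lemma AE_translation:
  assumes "AE x in M. P x"
  shows "AE x in M. P (x + z)"
  by (rule AE_distrD[OF translation_measurable[of z]]) (use assms in \<open>simp only: distr_translation\<close>)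

text \<open>A nonzero measure excludes \<open>False\<close> almost everywhere. This serves to
  evaluate at one point an almost-everywhere identity between constants.\<close>

lemma AE_ex:
  assumes "AE x in M. P x"
  obtains x where "P x"
proof -
  have "emeasure M (space M) \<noteq> 0"
    using emeasure_UNIV by simp
  then have "\<not> (AE x in M. False)"
    by (subst AE_iff_null) (auto simp: null_sets_def)
  then show thesis
    using assms that by (metis (mono_tags, lifting) eventually_mono)
qed

lemma translate_measurable:
  assumes "f \<in> borel_measurable M"
  shows "translate y f \<in> borel_measurable M"
  unfolding translate_def using measurable_compose[OF translation_measurable assms] .

lemma difference_measurable:
  assumes "f \<in> borel_measurable M"
  shows "difference y f \<in> borel_measurable M"
  using borel_measurable_diff[OF translate_measurable[OF assms, of y] assms]
  by (simp add: translate_def difference_def)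

lemma integrable_mult_unimodular:
  fixes f u :: "'a \<Rightarrow> complex"
  assumes "integrable M f" "u \<in> borel_measurable M" "\<And>x. norm (u x) = 1"
  shows "integrable M (\<lambda>x. u x * f x)"
  by (rule Bochner_Integration.integrable_bound[OF assms(1)])
    (use assms in \<open>auto simp: norm_mult intro!: borel_measurable_times borel_measurable_integrable\<close>)

text \<open>The two products have the same norm. This links \<open>star_conv_defined\<close>, which
  has no conjugate, to the integrand of the convolution.\<close>

lemma integrable_cnj_mult_iff:
  fixes f g :: "'a \<Rightarrow> complex"
  assumes [measurable]: "f \<in> borel_measurable M" "g \<in> borel_measurable M"
  shows "integrable M (\<lambda>x. cnj (f x) * g x) \<longleftrightarrow> integrable M (\<lambda>x. f x * g x)"
proof -
  have [measurable]: "(\<lambda>x. cnj (f x)) \<in> borel_measurable M"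
    by (intro borel_measurable_continuous_on[OF _ assms(1)] continuous_intros)
  have "(\<lambda>x. norm (cnj (f x) * g x)) = (\<lambda>x. norm (f x * g x))"
    by (simp add: norm_mult)
  then show ?thesis
    by (subst (1 2) integrable_norm_iff[symmetric]) auto
qed

section \<open>Convolution and differences\<close>

text \<open>Substitute \<open>y = t + x\<close>. Now \<open>x\<close> occurs only in the argument of
  \<open>\<phi>\<close>, so translating \<open>\<phi>\<close> amounts to translating the
  convolution.\<close>

lemma conv_star:
  assumes f: "f \<in> borel_measurable M" and \<phi>: "\<phi> \<in> borel_measurable M"
  shows "conv M (star f) \<phi> x = (\<integral>t. cnj (f t) * \<phi> (t + x) \<partial>M)"
proof -
  have "(\<lambda>t. cnj (f t) * translate x \<phi> t) \<in> borel_measurable M"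
    using translate_measurable[OF \<phi>, of x]
    by (intro borel_measurable_times borel_measurable_continuous_on[OF _ f] continuous_intros)
  from integral_translation[OF this, of "- x"] show ?thesis
    by (simp add: conv_def star_def translate_def)
qed

text \<open>This condition passes to differences of either argument, so inductions can carry it.
  Since a divergent integral has the default value 0, additivity is claimed only for almost every
  \<open>x\<close>. The convolution lemmas work with single integrals, never with Fubini, as
  \<open>M\<close> may fail to be sigma-finite.\<close>

definition conv_integrable :: "('a \<Rightarrow> complex) \<Rightarrow> ('a \<Rightarrow> complex) \<Rightarrow> bool" where
  "conv_integrable f \<phi> \<longleftrightarrow>
     f \<in> borel_measurable M \<and> \<phi> \<in> borel_measurable M \<and>
     (AE x in M. integrable M (\<lambda>t. cnj (f t) * \<phi> (t + x)))"

lemma conv_integrableI: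
  assumes "f \<in> L1 M" "\<phi> \<in> borel_measurable M" "star_conv_defined M f \<phi>"
  shows "conv_integrable f \<phi>"
proof -
  have f: "f \<in> borel_measurable M"
    using assms(1) by (auto simp: L1_def)
  have "AE x in M. integrable M (\<lambda>t. f t * translate x \<phi> t)"
    using assms(3) by (auto simp: star_conv_defined_def L1_def)
  then have "AE x in M. integrable M (\<lambda>t. cnj (f t) * translate x \<phi> t)"
    by (simp add: integrable_cnj_mult_iff f translate_measurable[OF assms(2)])
  then show ?thesis
    using f assms(2) by (simp add: conv_integrable_def translate_def)
qed

lemma conv_integrable_measurable:
  assumes "conv_integrable f \<phi>"
  shows "f \<in> borel_measurable M" "\<phi> \<in> borel_measurable M"
  using assms by (auto simp: conv_integrable_def)

lemma conv_star_difference_right: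
  assumes "conv_integrable f \<phi>"
  shows "conv_integrable f (difference z \<phi>)"
    and "AE x in M. conv M (star f) (difference z \<phi>) x =
           conv M (star f) \<phi> (x + z) - conv M (star f) \<phi> x"
proof -
  note m = conv_integrable_measurable[OF assms]
  have i: "AE x in M. integrable M (\<lambda>t. cnj (f t) * \<phi> (t + x))"
    using assms by (simp add: conv_integrable_def)
  \<comment> \<open>Splitting the integral at \<open>x\<close> needs convergence at both
    \<open>x\<close> and \<open>x + z\<close>; the translate of a null exceptional set is
    null.\<close>
  note i' = AE_translation[OF i, of z]
  show "conv_integrable f (difference z \<phi>)"
    unfolding conv_integrable_def
  proof (intro conjI m difference_measurable)
    show "AE x in M. integrable M (\<lambda>t. cnj (f t) * difference z \<phi> (t + x))"
      using i i'
    proof eventually_elim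
      case (elim x)
      from Bochner_Integration.integrable_diff[OF elim(2,1)] show ?case
        by (simp add: difference_def algebra_simps)
    qed
  qed
  show "AE x in M. conv M (star f) (difference z \<phi>) x =
          conv M (star f) \<phi> (x + z) - conv M (star f) \<phi> x"
    using i i'
  proof eventually_elim
    case (elim x)
    from Bochner_Integration.integral_diff[OF elim(2,1)] show ?case
      by (simp add: conv_star m difference_measurable) (simp add: difference_def algebra_simps)
  qed
qed

text \<open>Replacing \<open>t + z\<close> by \<open>t\<close> moves the shift from \<open>f\<close>
  to \<open>\<phi>\<close> and reverses its sign.\<close>

lemma conv_star_difference_left:
  assumes "conv_integrable f \<phi>"
  shows "conv_integrable (difference z f) \<phi>"
    and "AE x in M. conv M (star (difference z f)) \<phi> x = conv M (star f) (difference (- z) \<phi>) x"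
proof -
  note m = conv_integrable_measurable[OF assms]
  have i: "AE x in M. integrable M (\<lambda>t. cnj (f t) * \<phi> (t + x))"
    using assms by (simp add: conv_integrable_def)
  have meas: "(\<lambda>t. cnj (f t) * \<phi> (t + x)) \<in> borel_measurable M" for x
    using translate_measurable[OF m(2), of x] unfolding translate_def
    by (intro borel_measurable_times borel_measurable_continuous_on[OF _ m(1)] continuous_intros)
  \<comment> \<open>Written this way, the left side is the integrand for the base point
    \<open>x - z\<close>, evaluated at \<open>t + z\<close>, so translation invariance
    applies.\<close>
  have eq: "cnj (f (t + z)) * \<phi> (t + z + (x + - z)) = cnj (f (t + z)) * \<phi> (t + x)" for t x
    by (simp add: algebra_simps)
  have i': "AE x in M. integrable M (\<lambda>t. cnj (f (t + z)) * \<phi> (t + x))"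
    using AE_translation[OF i, of "- z"]
  proof eventually_elim
    case (elim x)
    then show ?case
      using integrable_translation[OF meas, of z "x + - z"] by (simp only: eq)
  qed
  show "conv_integrable (difference z f) \<phi>"
    unfolding conv_integrable_def
  proof (intro conjI m difference_measurable)
    show "AE x in M. integrable M (\<lambda>t. cnj (difference z f t) * \<phi> (t + x))"
      using i i'
    proof eventually_elim
      case (elim x)
      from Bochner_Integration.integrable_diff[OF elim(2,1)] show ?case
        by (simp add: difference_def algebra_simps)
    qed
  qed
  show "AE x in M. conv M (star (difference z f)) \<phi> x = conv M (star f) (difference (- z) \<phi>) x"
    using i i' conv_star_difference_right(2)[OF assms, of "- z"]
  proof eventually_elim
    case (elim x)
    have "conv M (star (difference z f)) \<phi> x =
        (\<integral>t. cnj (f (t + z)) * \<phi> (t + x) - cnj (f t) * \<phi> (t + x) \<partial>M)"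
      by (simp add: conv_star m difference_measurable) (simp add: difference_def algebra_simps)
    also have "\<dots> = (\<integral>t. cnj (f (t + z)) * \<phi> (t + x) \<partial>M) - (\<integral>t. cnj (f t) * \<phi> (t + x) \<partial>M)"
      by (rule Bochner_Integration.integral_diff[OF elim(2,1)])
    also have "(\<integral>t. cnj (f (t + z)) * \<phi> (t + x) \<partial>M) = (\<integral>t. cnj (f t) * \<phi> (t + (x + - z)) \<partial>M)"
      using integral_translation[OF meas, of z "x + - z"] by (simp only: eq)
    finally show ?case
      using elim(3) by (simp add: conv_star m)
  qed
qed

text \<open>The convolution with a difference is a difference of the convolution, and that vanishes
  wherever both of its terms do, hence almost everywhere.\<close>

lemma conv_star_foldr_difference_eq_0:
  assumes "conv_integrable f \<phi>" "AE x in M. conv M (star f) \<phi> x = 0"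
  shows "conv_integrable f (foldr difference ys \<phi>) \<and>
         (AE x in M. conv M (star f) (foldr difference ys \<phi>) x = 0)"
proof (induction ys)
  case (Cons y ys)
  let ?q = "foldr difference ys \<phi>"
  have zero: "AE x in M. conv M (star f) ?q x = 0" and q: "conv_integrable f ?q"
    using Cons by auto
  have "AE x in M. conv M (star f) (difference y ?q) x = 0"
    using conv_star_difference_right(2)[OF q, of y] zero AE_translation[OF zero, of y]
    by eventually_elim simp
  with conv_star_difference_right(1)[OF q] show ?case
    by simp
qed (use assms in simp)

lemma conv_star_funpow_difference:
  assumes "conv_integrable g \<phi>"
  shows "conv_integrable ((difference y ^^ k) g) \<phi> \<and>
         (AE x in M. conv M (star ((difference y ^^ k) g)) \<phi> x =
            conv M (star g) ((difference (- y) ^^ k) \<phi>) x)"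
  using assms
\<comment> \<open>Moving the outermost difference off \<open>g\<close> replaces
  \<open>\<phi>\<close> by \<open>difference (- y) \<phi>\<close>, to which the induction hypothesis
  must then apply.\<close>
proof (induction k arbitrary: \<phi>)
  case (Suc k)
  let ?h = "(difference y ^^ k) g" and ?\<psi> = "difference (- y) \<phi>"
  have h: "conv_integrable ?h \<phi>"
    using Suc by blast
  have "AE x in M. conv M (star ?h) ?\<psi> x = conv M (star g) ((difference (- y) ^^ k) ?\<psi>) x"
    using Suc.IH[OF conv_star_difference_right(1)[OF Suc.prems]] by blast
  with conv_star_difference_left(2)[OF h, of y]
  have "AE x in M. conv M (star (difference y ?h)) \<phi> x =
      conv M (star g) ((difference (- y) ^^ Suc k) \<phi>) x"
    by eventually_elim (simp only: funpow_Suc_right o_apply)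
  with conv_star_difference_left(1)[OF h, of y] show ?case
    by (simp only: funpow.simps o_apply simp_thms)
qed simp

section \<open>Fourier transforms of differences and of a dense subset\<close>

lemma fourier_integrable:
  assumes "f \<in> L1 M" "\<psi> \<in> dual_group"
  shows "integrable M (\<lambda>x. f x * \<psi> (- x))"
proof -
  have "integrable M (\<lambda>x. cnj (\<psi> x) * f x)"
    using dual_group_cnj[OF assms(2)] assms(1)
    by (intro integrable_mult_unimodular dual_group_measurable) (auto simp: L1_def dual_group_def)
  then show ?thesis
    by (simp add: dual_group_minus[OF assms(2)] mult.commute)
qed

lemma difference_in_L1:
  assumes "f \<in> L1 M"
  shows "difference y f \<in> L1 M"
proof -
  have f: "integrable M f"
    using assms by (simp add: L1_def)
  then have "integrable M (\<lambda>x. f (x + y))"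
    using integrable_translation[of f y] borel_measurable_integrable by blast
  then show ?thesis
    using f by (simp add: L1_def difference_def)
qed

text \<open>Since \<open>\<psi> (- x) = \<psi> (- (x + y)) * \<psi> y\<close>, invariance turns the
  translate of \<open>f\<close> into the factor \<open>\<psi> y\<close>.\<close>

lemma fourier_difference:
  assumes f: "f \<in> L1 M" and \<psi>: "\<psi> \<in> dual_group"
  shows "fourier M (difference y f) \<psi> = (\<psi> y - 1) * fourier M f \<psi>"
proof -
  note i = fourier_integrable[OF f \<psi>]
  note m = borel_measurable_integrable[OF i]
  have "difference y f x * \<psi> (- x) =
      \<psi> y * (f (x + y) * \<psi> (- (x + y))) - f x * \<psi> (- x)" for x
  proof -
    have "\<psi> (- (x + y) + y) = \<psi> (- (x + y)) * \<psi> y"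
      using \<psi> unfolding dual_group_def by blast
    moreover have "- (x + y) + y = - x"
      by simp
    ultimately have "\<psi> y * (f (x + y) * \<psi> (- (x + y))) = f (x + y) * \<psi> (- x)"
      by (simp only: mult_ac)
    then show ?thesis
      by (simp only: difference_def left_diff_distrib)
  qed
  moreover have "integrable M (\<lambda>x. \<psi> y * (f (x + y) * \<psi> (- (x + y))))"
    using integrable_translation[OF m, of y] i by (intro integrable_mult_right) simp
  moreover have "(\<integral>x. f (x + y) * \<psi> (- (x + y)) \<partial>M) = fourier M f \<psi>"
    using integral_translation[OF m, of y] by (simp add: fourier_def)
  ultimately show ?thesis
    using i by (simp add: fourier_def left_diff_distrib del: minus_add_distrib)
qed

lemma fourier_funpow_difference:
  assumes "f \<in> L1 M" "\<psi> \<in> dual_group"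
  shows "fourier M ((difference y ^^ k) f) \<psi> = (\<psi> y - 1) ^ k * fourier M f \<psi>"
proof -
  have "(difference y ^^ k) f \<in> L1 M" for k
    by (induction k) (auto intro: difference_in_L1 assms(1))
  then show ?thesis
    by (induction k) (auto simp: fourier_difference assms(2))
qed

text \<open>At \<open>\<psi>\<close>, the transforms of two functions differ by at most their L1
  distance, so it suffices to approximate one function whose transform there is positive.\<close>

lemma dense_fourier_nonzero:
  assumes F: "L1_dense_in M F (L1 M)" and \<psi>: "\<psi> \<in> dual_group"
  obtains g where "g \<in> F" "fourier M g \<psi> \<noteq> 0"
proof -
  obtain K where K: "compact K" "emeasure M K \<noteq> 0"
  proof -
    have "0 < (SUP K\<in>{K. compact K}. emeasure M K)"
      using emeasure_UNIV emeasure_UNIV_eq_SUP by (simp add: zero_less_iff_neq_zero)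
    then show thesis
      using that by (auto simp: less_SUP_iff)
  qed
  have Kb [measurable]: "K \<in> sets M"
    using K(1) by (simp add: borel_closed compact_imp_closed)
  have fin: "emeasure M K < \<infinity>"
    using emeasure_compact_finite K(1) .
  then have pos: "0 < measure M K"
    using K(2) by (simp add: measure_def enn2real_positive_iff zero_less_iff_neq_zero top.not_eq_extremum)
  \<comment> \<open>The factor \<open>\<psi>\<close> cancels the conjugate character in the
    transform, leaving the integral of the indicator, \<open>measure M K > 0\<close>.\<close>
  define h where "h = (\<lambda>x. \<psi> x * complex_of_real (indicator K x))"
  have iK: "integrable M (\<lambda>x. complex_of_real (indicator K x))"
    using fin Kb by (intro integrable_of_real integrable_real_indicator)
  then have h: "h \<in> L1 M"
    unfolding h_def L1_def using iK \<psi> dual_group_measurable[OF \<psi>]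
    by (auto intro!: integrable_mult_unimodular simp: dual_group_def)
  have "h x * \<psi> (- x) = complex_of_real (indicator K x)" for x
    using dual_group_mult_cnj[OF \<psi>, of x] by (simp add: h_def dual_group_minus[OF \<psi>] indicator_def)
  then have fh: "fourier M h \<psi> = of_real (measure M K)"
    using fin by (simp add: fourier_def)
  \<comment> \<open>With an error below \<open>measure M K\<close>, the transform of
    \<open>g\<close> cannot reach 0.\<close>
  obtain g where g: "g \<in> F" "(\<integral>x. norm (h x - g x) \<partial>M) < measure M K"
    using F h pos unfolding L1_dense_in_def by meson
  have gL: "g \<in> L1 M"
    using F g(1) by (auto simp: L1_dense_in_def)
  have "fourier M g \<psi> \<noteq> 0"
  proof
    assume "fourier M g \<psi> = 0"
    then have "of_real (measure M K) = (\<integral>x. h x * \<psi> (- x) - g x * \<psi> (- x) \<partial>M)"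
      using fh fourier_integrable[OF h \<psi>] fourier_integrable[OF gL \<psi>] by (simp add: fourier_def)
    then have "measure M K = norm (\<integral>x. h x * \<psi> (- x) - g x * \<psi> (- x) \<partial>M)"
      by (metis norm_of_real abs_of_pos pos)
    also have "\<dots> \<le> (\<integral>x. norm (h x * \<psi> (- x) - g x * \<psi> (- x)) \<partial>M)"
      by (rule integral_norm_bound)
    also have "\<dots> = (\<integral>x. norm (h x - g x) \<partial>M)"
      using \<psi> by (simp add: left_diff_distrib[symmetric] norm_mult dual_group_def)
    finally show False
      using g(2) by simp
  qed
  then show thesis
    using g(1) that by blast
qed

section \<open>Local boundedness and well-definedness\<close>

lemma continuous_in_Linf_loc:
  assumes "continuous_on UNIV \<phi>"
  shows "\<phi> \<in> Linf_loc M"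
  unfolding Linf_loc_def Linf_def
proof (intro CollectI allI impI conjI)
  fix K :: "'a set"
  assume K: "compact K"
  then have "K \<in> sets M"
    by (simp add: borel_closed compact_imp_closed)
  then show "(\<lambda>x. indicator K x * \<phi> x) \<in> borel_measurable M"
    using continuous_measurable[OF assms] by measurable
  have "compact (\<phi> ` K)"
    using K assms by (intro compact_continuous_image) (auto intro: continuous_on_subset)
  then obtain C where "\<forall>x\<in>K. norm (\<phi> x) \<le> C"
    using compact_imp_bounded by (force simp: bounded_iff)
  \<comment> \<open>Off \<open>K\<close> the product is 0, and for empty \<open>K\<close> the bound
    \<open>C\<close> may be negative; the absolute value covers both.\<close>
  then have "norm (indicator K x * \<phi> x) \<le> \<bar>C\<bar>" for x
    by (auto simp: indicator_def norm_mult intro: order_trans[OF _ abs_ge_self])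
  then show "\<exists>C. AE x in M. norm (indicator K x * \<phi> x) \<le> C"
    by blast
qed

text \<open>Both products change only by unimodular factors: \<open>\<gamma> x\<close> in the first,
  \<open>\<gamma> (x + y) = \<gamma> x * \<gamma> y\<close> in the second.\<close>

lemma star_conv_defined_mult_character:
  assumes \<gamma>: "\<gamma> \<in> dual_group" and def: "star_conv_defined M f \<phi>"
  shows "star_conv_defined M f (\<lambda>x. \<gamma> x * \<phi> x)"
  using def unfolding star_conv_defined_def
proof eventually_elim
  case (elim y)
  have *: "integrable M (\<lambda>x. \<gamma> x * h x)" if "h \<in> L1 M" for h
    using that \<gamma> dual_group_measurable[OF \<gamma>]
    by (auto intro!: integrable_mult_unimodular simp: dual_group_def L1_def)
  have "translate y f x * (\<gamma> x * \<phi> x) = \<gamma> x * (translate y f x * \<phi> x)" for x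
    by (simp only: mult.left_commute)
  moreover have "f x * translate y (\<lambda>x. \<gamma> x * \<phi> x) x = \<gamma> y * (\<gamma> x * (f x * translate y \<phi> x))" for x
    using \<gamma> by (simp add: translate_def dual_group_def mult_ac)
  moreover have "integrable M (\<lambda>x. \<gamma> y * (\<gamma> x * (f x * translate y \<phi> x)))"
    using *[of "\<lambda>x. f x * translate y \<phi> x"] elim by (intro integrable_mult_right) blast
  moreover have "integrable M (\<lambda>x. \<gamma> x * (translate y f x * \<phi> x))"
    using *[of "\<lambda>x. translate y f x * \<phi> x"] elim by blast
  ultimately show ?case
    by (simp only: L1_def mem_Collect_eq simp_thms)
qed

section \<open>Annihilators of a polynomial\<close>

lemma integral_eq_0_of_conv_star_eq_0:
  assumes p: "polynomial_of_degree n p" and f: "conv_integrable f p"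
    and zero: "AE x in M. conv M (star f) p x = 0"
  shows "(\<integral>x. f x \<partial>M) = 0"
proof -
  obtain ys c where c: "c \<noteq> 0" "foldr difference ys p = (\<lambda>_. c)"
    using foldr_difference_constant[OF p] .
  have "AE x in M. conv M (star f) (\<lambda>_. c) x = 0"
    using conv_star_foldr_difference_eq_0[OF f zero, of ys] c(2) by simp
  \<comment> \<open>Convolving with the constant \<open>c\<close> gives \<open>c\<close> times the
    conjugate of the integral of \<open>f\<close>, whatever \<open>x\<close> is, so one point
    suffices.\<close>
  then obtain x where "conv M (star f) (\<lambda>_. c) x = 0"
    using AE_ex by blast
  then show ?thesis
    using c(1) conv_integrable_measurable(1)[OF f] by (simp add: conv_star)
qed

text \<open>All n + 1 differences move across to \<open>p\<close>, where they have the common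
  direction \<open>- y\<close> and exceed the degree.\<close>

lemma conv_star_funpow_difference_eq_0:
  assumes p: "polynomial_of_degree n p" and g: "conv_integrable g p"
  shows "AE x in M. conv M (star ((difference y ^^ (n + 1)) g)) p x = 0"
proof -
  have "(difference (- y) ^^ (n + 1)) p = foldr difference (replicate (n + 1) (- y)) p"
    by (simp only: foldr_replicate)
  also have "\<dots> = (\<lambda>_. 0)"
    using p unfolding polynomial_of_degree_def by (metis length_replicate)
  finally show ?thesis
    using conv_star_funpow_difference[OF g, where y = y and k = "n + 1"] by (simp add: conv_def)
qed

end

section \<open>The spectrum of a character times a polynomial\<close>

theorem proposition3p6:
  fixes M :: "'a::{topological_ab_group_add, t2_space} measure"
    and p :: "'a \<Rightarrow> complex" and n :: nat and F :: "('a \<Rightarrow> complex) set"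
  assumes "locally_compact_space (euclidean :: 'a topology)"
    and "haar_measure M"
    and "polynomial_of_degree n p" and "p \<noteq> (\<lambda>_. 0)"
    and "L1_subalgebra M F"
    and "L1_dense_in M F (L1 M)"
    and "\<And>f y. f \<in> F \<Longrightarrow> translate y f \<in> F"
    and "\<And>f \<gamma>. f \<in> F \<Longrightarrow> \<gamma> \<in> dual_group \<Longrightarrow> (\<lambda>x. \<gamma> x * f x) \<in> F"
    and "\<And>\<gamma>. \<gamma> \<in> dual_group \<Longrightarrow>
           L1_dense_in M {f \<in> F. fourier M f \<gamma> = 0} {f \<in> L1 M. fourier M f \<gamma> = 0}"
    and "\<And>f. f \<in> F \<Longrightarrow> star_conv_defined M f p"
  shows "\<forall>\<gamma>\<in>dual_group.
           (\<lambda>x. \<gamma> x * p x) \<in> Linf_loc M \<and>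
           (\<forall>f\<in>F. star_conv_defined M f (\<lambda>x. \<gamma> x * p x)) \<and>
           sp M F (\<lambda>x. \<gamma> x * p x) = {\<gamma>}"
proof (intro ballI conjI)
  fix \<gamma> :: "'a \<Rightarrow> complex"
  assume \<gamma>: "\<gamma> \<in> dual_group"
  interpret haar M
    by unfold_locales (rule assms)
  have pc: "continuous_on UNIV p"
    using assms(3) by (simp add: polynomial_of_degree_def)
  have FL: "F \<subseteq> L1 M"
    using assms(6) by (simp add: L1_dense_in_def)
  have ci: "conv_integrable f p" if "f \<in> F" for f
    using that FL assms(10) pc by (intro conv_integrableI continuous_measurable) auto
  show "(\<lambda>x. \<gamma> x * p x) \<in> Linf_loc M"
    using \<gamma> pc by (intro continuous_in_Linf_loc continuous_intros) (simp_all add: dual_group_def)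
  show "star_conv_defined M f (\<lambda>x. \<gamma> x * p x)" if "f \<in> F" for f
    using star_conv_defined_mult_character[OF \<gamma> assms(10)[OF that]] .
  show "sp M F (\<lambda>x. \<gamma> x * p x) = {\<gamma>}"
  proof (intro equalityI subsetI)
    fix \<psi>
    assume \<psi>: "\<psi> \<in> sp M F (\<lambda>x. \<gamma> x * p x)"
    then have \<psi>d: "\<psi> \<in> dual_group"
      by (simp add: sp_def)
    \<comment> \<open>The quotient of \<open>\<psi>\<close> by \<open>\<gamma>\<close>: the
      transform of \<open>\<gamma> h\<close> at \<open>\<psi>\<close> is that of \<open>h\<close> at
      \<open>\<kappa>\<close>. The goal becomes that \<open>\<kappa>\<close> is trivial.\<close>
    define \<kappa> where "\<kappa> = (\<lambda>x. cnj (\<gamma> x) * \<psi> x)"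
    have \<kappa>: "\<kappa> \<in> dual_group"
      unfolding \<kappa>_def using dual_group_mult[OF dual_group_cnj[OF \<gamma>] \<psi>d] .
    obtain g where g: "g \<in> F" "fourier M g \<kappa> \<noteq> 0"
      using dense_fourier_nonzero[OF assms(6) \<kappa>] .
    have diff: "difference y f \<in> F" if "f \<in> F" for y f
    proof -
      have "(\<lambda>x. translate y f x + - 1 * f x) \<in> F"
        using assms(5,7) that unfolding L1_subalgebra_def by meson
      then show ?thesis
        by (simp add: translate_def difference_def)
    qed
    have "\<kappa> y = 1" for y
    proof -
      define h where "h = (difference y ^^ (n + 1)) g"
      have "(difference y ^^ k) g \<in> F" for k
        by (induction k) (auto intro: diff g(1))
      then have "(\<lambda>x. \<gamma> x * h x) \<in> F"
        unfolding h_def using assms(8)[OF _ \<gamma>] by blast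
      moreover have "AE x in M. conv M (star h) p x = 0"
        unfolding h_def by (rule conv_star_funpow_difference_eq_0[OF assms(3) ci[OF g(1)]])
      then have "AE x in M. conv M (star (\<lambda>x. \<gamma> x * h x)) (\<lambda>x. \<gamma> x * p x) x = 0"
        by eventually_elim (simp add: conv_star_mult_character[OF \<gamma>])
      ultimately have "fourier M (\<lambda>x. \<gamma> x * h x) \<psi> = 0"
        using \<psi> by (simp add: sp_def ann_ideal_def)
      \<comment> \<open>Each difference contributes one factor \<open>\<kappa> y - 1\<close>; as the
        transform of \<open>g\<close> at \<open>\<kappa>\<close> is nonzero, the power must
        vanish.\<close>
      then have "(\<kappa> y - 1) ^ (n + 1) * fourier M g \<kappa> = 0"
        using fourier_funpow_difference[of g \<kappa> "n + 1" y] g(1) FL \<kappa>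
        by (auto simp: fourier_mult_character[OF \<gamma>] h_def \<kappa>_def)
      then show ?thesis
        using g(2) by auto
    qed
    then have "\<psi> y = \<gamma> y" for y
      using dual_group_mult_cnj(1)[OF \<gamma>, of y] unfolding \<kappa>_def
      by (metis mult.assoc mult_1_left mult_1_right)
    then show "\<psi> \<in> {\<gamma>}"
      by auto
  next
    fix \<psi>
    assume "\<psi> \<in> {\<gamma>}"
    then have \<psi>: "\<psi> = \<gamma>"
      by simp
    have "fourier M f \<gamma> = 0" if f: "f \<in> ann_ideal M F (\<lambda>x. \<gamma> x * p x)" for f
    proof -
      \<comment> \<open>Removing \<open>\<gamma>\<close> from \<open>f\<close> stays in
        \<open>F\<close>, as the conjugate of \<open>\<gamma>\<close> is again a character. Then
        \<open>h\<close> annihilates \<open>p\<close>, and its integral is the transform of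
        \<open>f\<close> at \<open>\<gamma>\<close>.\<close>
      define h where "h = (\<lambda>x. cnj (\<gamma> x) * f x)"
      have fh: "f = (\<lambda>x. \<gamma> x * h x)"
        by (simp add: h_def mult.assoc[symmetric] dual_group_mult_cnj[OF \<gamma>])
      have "h \<in> F"
        unfolding h_def using f assms(8) dual_group_cnj[OF \<gamma>] by (auto simp: ann_ideal_def)
      moreover have "AE x in M. \<gamma> x * conv M (star h) p x = 0"
        using f by (simp add: ann_ideal_def fh conv_star_mult_character[OF \<gamma>])
      then have "AE x in M. conv M (star h) p x = 0"
      proof eventually_elim
        case (elim x)
        then show ?case
          using dual_group_mult_cnj(1)[OF \<gamma>, of x] by auto
      qed
      ultimately have "(\<integral>x. h x \<partial>M) = 0"
        using integral_eq_0_of_conv_star_eq_0[OF assms(3) ci] by blast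
      then show ?thesis
        by (simp add: fourier_def h_def dual_group_minus[OF \<gamma>] mult.commute)
    qed
    then show "\<psi> \<in> sp M F (\<lambda>x. \<gamma> x * p x)"
      using \<gamma> by (simp add: \<psi> sp_def)
  qed
qed

end
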